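(* Let $G$ be the infinite triangular lattice and let $X$ be a node2vec random walk on $G$ with parameters $\alpha\ge0$ and $\beta,\gamma>0$. Then $X$ is recurrent on $G$.
   Context: The infinite triangular lattice is the $6$-regular planar lattice graph, i.e. the graph on $\mathbb Z^2$ in which $x\sim y$ if and only if $y-x\in\{\pm(1,0),\pm(0,1),\pm(1,-1)\}$. Node2vec random walk on a simple graph $G=(V,E)$: the process $X=(X_n)_{n\ge0}$ on $V$ such that for $\{s,u\},\{u,v\}\in E$ and $n\ge 1$, $\mathbb P(X_{n+1}=v\mid X_n=u,X_{n-1}=s)$ is proportional (over neighbors $v$ of $u$) to $\alpha$ if $s=v$, to $\beta$ if $\{s,v\}\in E$, and to $\gamma$ if $\{s,v\}\notin E$ and $s\ne v$. Its initial distribution is a law for $(X_0,X_1)$ on the set of directed edges. $X$ is recurrent if every node $v\in V$ is visited infinitely often almost surely. *)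

theory Defs
  imports "HOL-Probability.Probability"
begin

locale simple_graph =
  fixes V :: "'a set" and E :: "'a set set"
  assumes edgeD: "e \<in> E \<Longrightarrow> \<exists>u\<in>V. \<exists>v\<in>V. u \<noteq> v \<and> e = {u, v}"
begin

definition nbrs :: "'a \<Rightarrow> 'a set" where
  "nbrs u = {v \<in> V. {u, v} \<in> E}"

definition n2v_weight :: "real \<Rightarrow> real \<Rightarrow> real \<Rightarrow> 'a \<Rightarrow> 'a \<Rightarrow> real" where
  "n2v_weight \<alpha> \<beta> \<gamma> s v = (if v = s then \<alpha> else if {s, v} \<in> E then \<beta> else \<gamma>)"

text \<open>Probability of stepping from \<open>u\<close> to \<open>v\<close> when the previous position was \<open>s\<close>.\<close>

definition n2v_prob :: "real \<Rightarrow> real \<Rightarrow> real \<Rightarrow> 'a \<Rightarrow> 'a \<Rightarrow> 'a \<Rightarrow> real" where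
  "n2v_prob \<alpha> \<beta> \<gamma> s u v =
     (if v \<in> nbrs u
      then n2v_weight \<alpha> \<beta> \<gamma> s v / (\<Sum>w\<in>nbrs u. n2v_weight \<alpha> \<beta> \<gamma> s w)
      else 0)"

end

text \<open>
  The walk is a second-order Markov chain: its transition law is prescribed conditionally on
  the whole history \<open>X\<^sub>0, \<dots>, X\<^sub>n\<close> (whenever that history has positive probability) and depends
  only on the last two positions.  Local finiteness makes the normalising sum in
  \<open>n2v_prob\<close> a finite one.  The initial law of \<open>(X\<^sub>0, X\<^sub>1)\<close> is arbitrary on directed edges.
\<close>

locale node2vec_walk = prob_space M + simple_graph V E
  for M :: "'w measure" and V :: "'a set" and E :: "'a set set" +
  fixes \<alpha> \<beta> \<gamma> :: real and X :: "nat \<Rightarrow> 'w \<Rightarrow> 'a"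
  assumes locally_finite: "u \<in> V \<Longrightarrow> finite (nbrs u)"
    and random_variable_X: "random_variable (count_space V) (X n)"
    and initial_edge: "AE \<omega> in M. {X 0 \<omega>, X 1 \<omega>} \<in> E"
    and transition:
      "\<lbrakk>n \<ge> 1; \<P>(\<omega> in M. \<forall>i\<le>n. X i \<omega> = x i) > 0; v \<in> V\<rbrakk> \<Longrightarrow>
         \<P>(\<omega> in M. X (n + 1) \<omega> = v \<bar> \<forall>i\<le>n. X i \<omega> = x i)
           = n2v_prob \<alpha> \<beta> \<gamma> (x (n - 1)) (x n) v"

definition recurrent :: "'w measure \<Rightarrow> 'a set \<Rightarrow> (nat \<Rightarrow> 'w \<Rightarrow> 'a) \<Rightarrow> bool" where
  "recurrent M V X \<longleftrightarrow> (\<forall>v\<in>V. AE \<omega> in M. \<exists>\<^sub>\<infinity>n. X n \<omega> = v)"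

definition tri_vertices :: "(int \<times> int) set" where
  "tri_vertices = UNIV"

definition tri_edges :: "(int \<times> int) set set" where
  "tri_edges = {{x, y} | x y. y - x \<in> {(1,0), (-1,0), (0,1), (0,-1), (1,-1), (-1,1)}}"

lemma simple_graph_tri: "simple_graph tri_vertices tri_edges"
proof
  fix e assume "e \<in> tri_edges"
  then obtain x y where "e = {x, y}"
    and d: "y - x \<in> {(1,0), (-1,0), (0,1), (0,-1), (1,-1), (-1,1)}"
    unfolding tri_edges_def by blast
  moreover have "x \<noteq> y"
  proof
    assume "x = y"
    with d show False by (simp add: zero_prod_def)
  qed
  ultimately show "\<exists>u\<in>tri_vertices. \<exists>v\<in>tri_vertices. u \<noteq> v \<and> e = {u, v}"
    unfolding tri_vertices_def by blast
qed

lemma tri_edges_iff: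
  "{x, y} \<in> tri_edges \<longleftrightarrow> y - x \<in> {(1,0), (-1,0), (0,1), (0,-1), (1,-1), (-1,1)}"
  (is "_ \<longleftrightarrow> _ \<in> ?S")
proof
  assume "{x, y} \<in> tri_edges"
  then obtain x' y' where eq: "{x, y} = {x', y'}" and d: "y' - x' \<in> ?S"
    unfolding tri_edges_def by blast
  have "- (y' - x') \<in> ?S" using d by (elim insertE emptyE) simp_all
  then have "x' - y' \<in> ?S" by (simp only: minus_diff_eq)
  with eq d show "y - x \<in> ?S" by (metis doubleton_eq_iff)
next
  assume "y - x \<in> ?S"
  then show "{x, y} \<in> tri_edges" unfolding tri_edges_def by blast
qed

lemma nbrs_tri:
  "simple_graph.nbrs tri_vertices tri_edges (a, b) =
     {(a+1,b), (a-1,b), (a,b+1), (a,b-1), (a+1,b-1), (a-1,b+1)}"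
  unfolding simple_graph.nbrs_def[OF simple_graph_tri] tri_edges_iff
  by (auto simp: tri_vertices_def)

end

theory Submission
  imports Defs
begin

text \<open>
  Put \<open>u - s\<close> for the current direction of travel.  On the triangular lattice the weight of the next
  step depends only on the angle by which it turns: \<open>\<gamma>\<close> for turns by \<open>0\<close> and \<open>\<plusminus>60\<close> degrees, \<open>\<beta>\<close> for
  \<open>\<plusminus>120\<close> degrees, \<open>\<alpha>\<close> for a reversal.  So the directed edges \<open>(X\<^sub>n\<^sub>-\<^sub>1, X\<^sub>n)\<close> form a Markov chain, a random walk
  whose turning angles are independent with a symmetric law.  It should return like a planar simple random
  walk, with probability of order \<open>1/n\<close> at time \<open>n\<close>, and such return probabilities have infinite sum.

  For a reversible chain, \<open>p\<^sub>2\<^sub>n(a,a) \<ge> \<Sum>\<^sub>x p\<^sub>n(a,x)\<^sup>2\<close> up to constants, and the sum of squares is at least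
  \<open>c/n\<close> by Cauchy--Schwarz as soon as the chain has a fixed chance to lie within distance \<open>O(\<surd>n)\<close> of its start.
  The edge chain is not reversible.  A point reflection of the lattice can take its place, provided the
  direction of travel can be reset without moving.  This is possible in three steps: walking round a triangle at
  \<open>x\<close> ends at \<open>x\<close> with any prescribed last edge, and one of the two triangles needs no immediate reversal, so
  positivity of \<open>\<beta>\<close> and \<open>\<gamma>\<close> suffices (\<open>triangle_detour\<close>).  To return to the start \<open>a = (z, v)\<close>, walk to some \<open>x\<close>,
  turn into the image of \<open>a\<close> under the point reflection exchanging \<open>x\<close> and \<open>v\<close>, walk to \<open>v\<close>, and turn into
  \<open>a\<close>.  The second walk is the reflection of a walk from \<open>v\<close> to \<open>x\<close>, so it is as likely as the first;
  this gives \<open>return_ge_collision\<close>.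

  The second moment is controlled by a quadratic function of position and direction that grows by a constant in
  expectation at every step (\<open>expectation_step_potential\<close>).  Divergence of the return probabilities
  follows (\<open>not_summable_return\<close>), and a last exit decomposition turns it into certain return to \<open>a\<close>;
  irreducibility extends this to every starting edge.  Conditioning the process on each of its countably many
  histories up to time \<open>n\<close> shows that every directed edge is almost surely traversed after time \<open>n\<close>, for every \<open>n\<close>.
\<close>

section \<open>Return probabilities and hitting in a countable Markov chain\<close>

primrec chain_at :: "('s \<Rightarrow> 's pmf) \<Rightarrow> nat \<Rightarrow> 's \<Rightarrow> 's pmf" where
  "chain_at K 0 s = return_pmf s"
| "chain_at K (Suc n) s = bind_pmf (K s) (chain_at K n)"

lemma chain_at_add: "chain_at K (m + n) s = bind_pmf (chain_at K m s) (chain_at K n)"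
proof (induction m arbitrary: s)
  case 0
  show ?case by (simp add: bind_return_pmf)
next
  case (Suc m)
  have "chain_at K (m + n) = (\<lambda>t. bind_pmf (chain_at K m t) (chain_at K n))"
    using Suc by (rule ext)
  then show ?case by (simp add: bind_assoc_pmf)
qed

lemma reachable_of_chain_at:
  "t \<in> set_pmf (chain_at K n s) \<Longrightarrow> (s, t) \<in> {(s, t). t \<in> set_pmf (K s)}\<^sup>*"
proof (induction n arbitrary: s)
  case (Suc n)
  then obtain s' where "s' \<in> set_pmf (K s)" "t \<in> set_pmf (chain_at K n s')" by auto
  then show ?case using Suc.IH[of s'] by (auto intro: converse_rtrancl_into_rtrancl)
qed simp

lemma integrable_pmf_unit_interval:
  fixes f :: "'s \<Rightarrow> real"
  assumes "\<And>t. 0 \<le> f t" "\<And>t. f t \<le> 1"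
  shows "integrable (measure_pmf p) f"
  by (rule measure_pmf.integrable_const_bound[where B = 1]) (use assms in auto)

lemma pmf_bind_ge:
  "pmf p x * pmf (f x) y \<le> pmf (bind_pmf p f) y"
proof -
  have "pmf p x * pmf (f x) y = measure_pmf.expectation p (\<lambda>t. indicator {x} t * pmf (f x) y)"
    by (simp add: measure_pmf_single)
  also have "\<dots> \<le> measure_pmf.expectation p (\<lambda>t. pmf (f t) y)"
    by (intro integral_mono integrable_pmf_unit_interval)
       (auto simp: indicator_def pmf_le_1)
  finally show ?thesis by (simp add: pmf_bind)
qed

text \<open>
  The probability that the chain started at \<open>s\<close> does not visit \<open>a\<close> at any of the times \<open>1, \<dots>, n\<close>.
\<close>
primrec avoid :: "('s \<Rightarrow> 's pmf) \<Rightarrow> 's \<Rightarrow> nat \<Rightarrow> 's \<Rightarrow> real" where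
  "avoid K a 0 s = 1"
| "avoid K a (Suc n) s = measure_pmf.expectation (K s) (\<lambda>t. if t = a then 0 else avoid K a n t)"

lemma avoid_bounds: "0 \<le> avoid K a n s \<and> avoid K a n s \<le> 1"
proof (induction n arbitrary: s)
  case (Suc n)
  have i: "integrable (measure_pmf (K s)) (\<lambda>t. if t = a then 0 else avoid K a n t)"
    by (rule integrable_pmf_unit_interval) (use Suc in auto)
  have "measure_pmf.expectation (K s) (\<lambda>t. if t = a then 0 else avoid K a n t) \<le> 1"
    by (rule measure_pmf.integral_le_const[OF i]) (use Suc in auto)
  moreover have "0 \<le> measure_pmf.expectation (K s) (\<lambda>t. if t = a then 0 else avoid K a n t)"
    by (rule integral_nonneg_AE) (use Suc in auto)
  ultimately show ?case by simp
qed simp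

lemma integrable_avoid:
  "integrable (measure_pmf p) (\<lambda>t. if t = a then 0 else avoid K a n t)"
  by (rule integrable_pmf_unit_interval) (simp_all add: avoid_bounds)

lemma avoid_Suc_le: "avoid K a (Suc n) s \<le> avoid K a n s"
proof (induction n arbitrary: s)
  case 0
  show ?case using avoid_bounds[of K a "Suc 0" s] by simp
next
  case (Suc n)
  have "measure_pmf.expectation (K s) (\<lambda>t. if t = a then 0 else avoid K a (Suc n) t)
      \<le> measure_pmf.expectation (K s) (\<lambda>t. if t = a then 0 else avoid K a n t)"
    by (rule integral_mono[OF integrable_avoid integrable_avoid]) (use Suc in auto)
  then show ?case by simp
qed

lemma avoid_antimono: "m \<le> n \<Longrightarrow> avoid K a n s \<le> avoid K a m s"
  by (rule lift_Suc_antimono_le[of "\<lambda>n. avoid K a n s"]) (use avoid_Suc_le in auto)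

text \<open>
  The summands are the probabilities that the last visit to \<open>a\<close> up to time \<open>N\<close> takes place at time \<open>n\<close>; the
  right-hand side is the probability that there is such a visit, time \<open>0\<close> included.  The induction conditions on
  the first step, which is why \<open>s\<close> is arbitrary.
\<close>
lemma last_exit_decomposition:
  "(\<Sum>n\<le>N. pmf (chain_at K n s) a * avoid K a (N - n) a) = 1 - (if s = a then 0 else avoid K a N s)"
proof (induction N arbitrary: s)
  case 0
  show ?case by (auto simp: pmf_return indicator_def)
next
  case (Suc N)
  have int: "integrable (measure_pmf (K s)) (\<lambda>t. pmf (chain_at K n t) a * avoid K a (N - n) a)" for n
    by (intro integrable_mult_left integrable_pmf_unit_interval) (auto simp: pmf_le_1)
  have "(\<Sum>n\<le>N. pmf (chain_at K (Suc n) s) a * avoid K a (N - n) a)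
      = measure_pmf.expectation (K s) (\<lambda>t. \<Sum>n\<le>N. pmf (chain_at K n t) a * avoid K a (N - n) a)"
    by (subst Bochner_Integration.integral_sum[OF int]) (simp add: pmf_bind)
  also have "\<dots> = 1 - avoid K a (Suc N) s"
    by (subst Suc) (simp add: Bochner_Integration.integral_diff[OF _ integrable_avoid])
  finally have "(\<Sum>n\<le>N. pmf (chain_at K (Suc n) s) a * avoid K a (N - n) a) = 1 - avoid K a (Suc N) s" .
  then show ?case
    unfolding sum.atMost_Suc_shift by (auto simp: pmf_return indicator_def simp del: avoid.simps chain_at.simps(2))
qed

text \<open>
  In the last exit decomposition from \<open>a\<close>, every factor \<open>avoid K a (N - n) a\<close> is at least \<open>avoid K a N a\<close>, so
  \<open>avoid K a N a\<close> times a partial sum of the return probabilities is at most \<open>1\<close>.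
\<close>
lemma avoid_self_tendsto_0:
  assumes "\<not> summable (\<lambda>n. pmf (chain_at K n a) a)"
  shows "(\<lambda>N. avoid K a N a) \<longlonglongrightarrow> 0"
proof (rule LIMSEQ_I)
  fix r :: real assume r: "0 < r"
  let ?G = "\<lambda>N. \<Sum>n\<le>N. pmf (chain_at K n a) a"
  have "\<exists>N. ?G N > 1 / r"
  proof (rule ccontr)
    assume "\<nexists>N. ?G N > 1 / r"
    then have bound: "?G n \<le> 1 / r" for n by (simp add: not_less)
    have "(\<Sum>i<n. pmf (chain_at K i a) a) \<le> 1 / r" for n
    proof -
      have "(\<Sum>i<n. pmf (chain_at K i a) a) \<le> ?G n" by (intro sum_mono2) auto
      then show ?thesis using bound[of n] by linarith
    qed
    then have "summable (\<lambda>n. pmf (chain_at K n a) a)"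
      by (intro summableI_nonneg_bounded[of _ "1/r"]) auto
    with assms show False by simp
  qed
  then obtain N0 where N0: "?G N0 > 1 / r" by blast
  have "avoid K a N a < r" if "N \<ge> N0" for N
  proof -
    have "?G N0 * avoid K a N a = (\<Sum>n\<le>N0. pmf (chain_at K n a) a * avoid K a N a)"
      by (simp add: sum_distrib_right)
    also have "\<dots> \<le> (\<Sum>n\<le>N0. pmf (chain_at K n a) a * avoid K a (N0 - n) a)"
      using that by (intro sum_mono mult_left_mono avoid_antimono) auto
    also have "\<dots> = 1" by (simp add: last_exit_decomposition)
    finally have le: "?G N0 * avoid K a N a \<le> 1" .
    show ?thesis
    proof (rule ccontr)
      assume "\<not> avoid K a N a < r"
      then have "?G N0 * r \<le> ?G N0 * avoid K a N a"
        by (intro mult_left_mono sum_nonneg) auto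
      moreover have "1 < ?G N0 * r" using N0 r by (simp add: field_simps)
      ultimately show False using le by simp
    qed
  qed
  then show "\<exists>no. \<forall>n\<ge>no. norm (avoid K a n a - 0) < r"
    using avoid_bounds[of K a _ a] by (intro exI[of _ N0]) auto
qed

text \<open>
  A chain that could escape from \<open>a\<close> after reaching \<open>t\<close> could also escape after starting from \<open>a\<close>.
\<close>
lemma avoid_tendsto_0_of_reachable:
  assumes "(\<lambda>N. avoid K a N a) \<longlonglongrightarrow> 0"
    and "(a, t) \<in> {(s, t). t \<in> set_pmf (K s)}\<^sup>*"
  shows "(\<lambda>N. avoid K a N t) \<longlonglongrightarrow> 0"
  using assms(2)
proof induction
  case base
  show ?case by (rule assms(1))
next
  case (step s t)
  show ?case
  proof (cases "t = a")
    case False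
    have pos: "pmf (K s) t > 0" using step by (simp add: pmf_positive)
    have "pmf (K s) t * avoid K a N t \<le> avoid K a (Suc N) s" for N
    proof -
      have "pmf (K s) t * avoid K a N t
          = measure_pmf.expectation (K s) (\<lambda>x. indicator {t} x * avoid K a N t)"
        by (simp add: measure_pmf_single)
      also have "\<dots> \<le> avoid K a (Suc N) s"
        unfolding avoid.simps using False avoid_bounds[of K a N]
        by (intro integral_mono[OF _ integrable_avoid] integrable_mult_left)
           (auto split: split_indicator simp: integrable_real_indicator measure_pmf.emeasure_eq_measure)
      finally show ?thesis .
    qed
    then have upper: "avoid K a N t \<le> avoid K a (Suc N) s / pmf (K s) t" for N
      using pos by (simp add: field_simps del: avoid.simps)
    have lim: "(\<lambda>N. avoid K a (Suc N) s / pmf (K s) t) \<longlonglongrightarrow> 0"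
      using tendsto_divide_zero[OF LIMSEQ_Suc[OF step.IH]] .
    show ?thesis
    proof (rule tendsto_sandwich[OF _ _ tendsto_const lim])
      show "\<forall>\<^sub>F N in sequentially. 0 \<le> avoid K a N t" by (simp add: avoid_bounds)
      show "\<forall>\<^sub>F N in sequentially. avoid K a N t \<le> avoid K a (Suc N) s / pmf (K s) t"
        by (rule always_eventually) (use upper in blast)
    qed
  qed (use assms(1) in simp)
qed

text \<open>
  The right-hand side is the probability that two independent samples of \<open>p\<close> agree; a law that charges a
  small set cannot make this small.
\<close>
lemma collision_probability_ge:
  assumes "finite B" "B \<noteq> {}"
  shows "(measure_pmf.prob p B)\<^sup>2 / card B \<le> measure_pmf.expectation p (pmf p)"
proof -
  have "(measure_pmf.prob p B)\<^sup>2 = (\<Sum>x\<in>B. pmf p x * 1)\<^sup>2"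
    using assms by (simp add: measure_measure_pmf_finite)
  also have "\<dots> \<le> (\<Sum>x\<in>B. (pmf p x)\<^sup>2) * (\<Sum>x\<in>B. 1\<^sup>2)"
    by (rule Cauchy_Schwarz_ineq_sum)
  also have "(\<Sum>x\<in>B. (pmf p x)\<^sup>2) = measure_pmf.expectation p (\<lambda>x. pmf p x * indicator B x)"
    by (subst integral_measure_pmf_real[OF assms(1)]) (auto simp: power2_eq_square indicator_def)
  also have "\<dots> \<le> measure_pmf.expectation p (pmf p)"
    by (intro integral_mono integrable_pmf_unit_interval) (auto simp: indicator_def pmf_le_1)
  finally show ?thesis
    using assms by (simp add: divide_le_eq card_gt_0_iff mult_right_mono)
qed

section \<open>The walk as a Markov chain on directed edges\<close>

lemma (in simple_graph) n2v_prob_automorphism: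
  assumes "bij_betw \<sigma> V V"
    and "\<And>p q. p \<in> V \<Longrightarrow> q \<in> V \<Longrightarrow> {\<sigma> p, \<sigma> q} \<in> E \<longleftrightarrow> {p, q} \<in> E"
    and "s \<in> V" "u \<in> V" "v \<in> V"
  shows "n2v_prob \<alpha> \<beta> \<gamma> (\<sigma> s) (\<sigma> u) (\<sigma> v) = n2v_prob \<alpha> \<beta> \<gamma> s u v"
proof -
  have inj: "inj_on \<sigma> V" and im: "\<sigma> ` V = V"
    using assms(1) by (auto simp: bij_betw_def)
  have w: "n2v_weight \<alpha> \<beta> \<gamma> (\<sigma> s) (\<sigma> x) = n2v_weight \<alpha> \<beta> \<gamma> s x" if "x \<in> V" for x
    using assms that inj_onD[OF inj, of x s] by (auto simp: n2v_weight_def)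
  have nb: "nbrs (\<sigma> u) = \<sigma> ` nbrs u"
  proof
    show "nbrs (\<sigma> u) \<subseteq> \<sigma> ` nbrs u"
    proof
      fix y assume y: "y \<in> nbrs (\<sigma> u)"
      then obtain x where "x \<in> V" "y = \<sigma> x" using im by (auto simp: nbrs_def)
      then show "y \<in> \<sigma> ` nbrs u" using y assms by (auto simp: nbrs_def)
    qed
    show "\<sigma> ` nbrs u \<subseteq> nbrs (\<sigma> u)" using assms im by (auto simp: nbrs_def)
  qed
  have sub: "nbrs u \<subseteq> V" by (auto simp: nbrs_def)
  have "(\<Sum>x\<in>nbrs (\<sigma> u). n2v_weight \<alpha> \<beta> \<gamma> (\<sigma> s) x) = (\<Sum>x\<in>nbrs u. n2v_weight \<alpha> \<beta> \<gamma> s x)"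
    unfolding nb using sub by (subst sum.reindex) (auto intro!: sum.cong w inj_on_subset[OF inj])
  moreover have "\<sigma> v \<in> nbrs (\<sigma> u) \<longleftrightarrow> v \<in> nbrs u"
    using assms im by (auto simp: nbrs_def)
  ultimately show ?thesis using w[OF assms(5)] by (simp add: n2v_prob_def)
qed

locale tri_node2vec =
  fixes \<alpha> \<beta> \<gamma> :: real
  assumes \<alpha>_nonneg: "\<alpha> \<ge> 0" and \<beta>_pos: "\<beta> > 0" and \<gamma>_pos: "\<gamma> > 0"
begin

sublocale simple_graph tri_vertices tri_edges by (rule simple_graph_tri)

abbreviation "weight \<equiv> n2v_weight \<alpha> \<beta> \<gamma>"
abbreviation "prob_next \<equiv> n2v_prob \<alpha> \<beta> \<gamma>"

lemma in_nbrs_iff: "v \<in> nbrs u \<longleftrightarrow> v - u \<in> {(1,0), (-1,0), (0,1), (0,-1), (1,-1), (-1,1)}"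
  unfolding nbrs_def tri_edges_iff by (simp add: tri_vertices_def)

lemma nbrs_sym: "v \<in> nbrs u \<longleftrightarrow> u \<in> nbrs v"
  unfolding nbrs_def by (simp add: tri_vertices_def insert_commute)

lemma not_in_own_nbrs: "u \<notin> nbrs u"
  by (simp add: in_nbrs_iff zero_prod_def)

lemma finite_nbrs: "finite (nbrs u)"
  by (cases u) (simp add: nbrs_tri)

lemma card_nbrs: "card (nbrs u) = 6"
  by (cases u) (simp add: nbrs_tri)

lemma weight_nonneg: "0 \<le> weight s v"
  using \<alpha>_nonneg \<beta>_pos \<gamma>_pos by (simp add: n2v_weight_def)

text \<open>
  Since \<open>\<alpha>\<close> may vanish, positivity rests on a neighbour of \<open>u\<close> other than \<open>s\<close>.
\<close>
lemma sum_weight_pos: "0 < (\<Sum>w\<in>nbrs u. weight s w)"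
proof -
  have "\<not> nbrs u \<subseteq> {s}"
    using card_mono[of "{s}" "nbrs u"] by (auto simp: card_nbrs)
  then obtain w where w: "w \<in> nbrs u" "w \<noteq> s" by blast
  have "0 < weight s w" using w \<beta>_pos \<gamma>_pos by (simp add: n2v_weight_def)
  then show ?thesis using w by (intro sum_pos2[OF finite_nbrs]) (auto simp: weight_nonneg)
qed

lemma sum_weight_le: "(\<Sum>w\<in>nbrs u. weight s w) \<le> 6 * (\<alpha> + \<beta> + \<gamma>)"
proof -
  have "(\<Sum>w\<in>nbrs u. weight s w) \<le> of_nat (card (nbrs u)) * (\<alpha> + \<beta> + \<gamma>)"
    using \<alpha>_nonneg \<beta>_pos \<gamma>_pos by (intro sum_bounded_above) (auto simp: n2v_weight_def)
  then show ?thesis by (simp add: card_nbrs)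
qed

lemma prob_next_nonneg: "0 \<le> prob_next s u v"
  using sum_weight_pos[of s u] by (simp add: n2v_prob_def weight_nonneg)

lemma sum_prob_next: "(\<Sum>v\<in>nbrs u. prob_next s u v) = 1"
proof -
  have "(\<Sum>v\<in>nbrs u. prob_next s u v) = (\<Sum>v\<in>nbrs u. weight s v / (\<Sum>w\<in>nbrs u. weight s w))"
    by (intro sum.cong) (auto simp: n2v_prob_def)
  also have "\<dots> = 1"
    using sum_weight_pos[of s u] by (simp flip: sum_divide_distrib)
  finally show ?thesis .
qed

lemma prob_next_eq_0: "v \<notin> nbrs u \<Longrightarrow> prob_next s u v = 0"
  by (simp add: n2v_prob_def)

text \<open>
  Steps that do not backtrack have probability at least \<open>\<delta>\<close>; a reversal may be impossible, as \<open>\<alpha>\<close> may vanish.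
\<close>
definition \<delta> :: real where
  "\<delta> = min \<beta> \<gamma> / (6 * (\<alpha> + \<beta> + \<gamma>))"

lemma \<delta>_pos: "0 < \<delta>"
  using \<alpha>_nonneg \<beta>_pos \<gamma>_pos by (simp add: \<delta>_def)

lemma prob_next_ge: "v \<in> nbrs u \<Longrightarrow> v \<noteq> s \<Longrightarrow> \<delta> \<le> prob_next s u v"
  using sum_weight_pos[of s u] sum_weight_le[of s u] \<beta>_pos \<gamma>_pos
  unfolding \<delta>_def n2v_prob_def by (auto simp: n2v_weight_def intro!: frac_le)

text \<open>
  The state \<open>(s, u)\<close> records the previous and the current position.  The pairs need not be edges: the
  normalising sum is positive for all \<open>s\<close>, so the kernel is defined everywhere, and \<open>is_edge\<close> below marks the
  states that the walk really visits.
\<close>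
definition step :: "(int \<times> int) \<times> (int \<times> int) \<Rightarrow> ((int \<times> int) \<times> (int \<times> int)) pmf" where
  "step e = map_pmf (Pair (snd e)) (embed_pmf (prob_next (fst e) (snd e)))"

lemma pmf_embed_prob_next: "pmf (embed_pmf (prob_next s u)) v = prob_next s u v"
proof (rule pmf_embed_pmf)
  have "(\<integral>\<^sup>+x. ennreal (prob_next s u x) \<partial>count_space UNIV)
      = (\<integral>\<^sup>+x. ennreal (prob_next s u x) \<partial>count_space (nbrs u))"
    by (rule nn_integral_count_space_eq) (auto simp: prob_next_eq_0)
  also have "\<dots> = 1"
    by (simp add: nn_integral_count_space_finite finite_nbrs prob_next_nonneg sum_prob_next)
  finally show "(\<integral>\<^sup>+x. ennreal (prob_next s u x) \<partial>count_space UNIV) = 1" .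
qed (rule prob_next_nonneg)

lemma pmf_step: "pmf (step (s, u)) (u', v) = (if u' = u then prob_next s u v else 0)"
proof (cases "u' = u")
  case True
  then show ?thesis
    by (simp add: step_def pmf_map_inj' inj_on_def pmf_embed_prob_next)
next
  case False
  then have "(u', v) \<notin> set_pmf (step (s, u))" by (auto simp: step_def)
  then show ?thesis using False by (simp add: pmf_eq_0_set_pmf)
qed

lemma set_pmf_step:
  assumes "e' \<in> set_pmf (step e)"
  shows "fst e' = snd e \<and> snd e' \<in> nbrs (snd e)"
proof -
  have "pmf (step (fst e, snd e)) (fst e', snd e') \<noteq> 0"
    using assms by (simp add: set_pmf_iff)
  then show ?thesis
    using prob_next_eq_0[of "snd e'" "snd e" "fst e"] unfolding pmf_step by presburger
qed

lemma expectation_step: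
  fixes f :: "(int \<times> int) \<times> (int \<times> int) \<Rightarrow> real"
  shows "measure_pmf.expectation (step (s, u)) f = (\<Sum>v\<in>nbrs u. prob_next s u v * f (u, v))"
proof -
  have "measure_pmf.expectation (step (s, u)) f = (\<Sum>e\<in>Pair u ` nbrs u. f e * pmf (step (s, u)) e)"
    using set_pmf_step[of _ "(s, u)"] by (intro integral_measure_pmf_real) (force simp: finite_nbrs)+
  also have "\<dots> = (\<Sum>v\<in>nbrs u. prob_next s u v * f (u, v))"
    by (subst sum.reindex) (auto simp: inj_on_def pmf_step mult.commute)
  finally show ?thesis .
qed

abbreviation "walk \<equiv> chain_at step"

definition is_edge :: "(int \<times> int) \<times> (int \<times> int) \<Rightarrow> bool" where
  "is_edge e \<longleftrightarrow> snd e \<in> nbrs (fst e)"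

lemma is_edge_walk: "is_edge e \<Longrightarrow> e' \<in> set_pmf (walk n e) \<Longrightarrow> is_edge e'"
proof (induction n arbitrary: e)
  case (Suc n)
  then obtain e1 where "e1 \<in> set_pmf (step e)" "e' \<in> set_pmf (walk n e1)" by auto
  moreover from this have "is_edge e1" using set_pmf_step by (simp add: is_edge_def)
  ultimately show ?case using Suc.IH by blast
qed simp

lemma finite_set_pmf_step: "finite (set_pmf (step e))"
proof -
  have "set_pmf (step e) \<subseteq> Pair (snd e) ` nbrs (snd e)"
    using set_pmf_step by (metis imageI prod.collapse subsetI)
  then show ?thesis by (rule finite_subset) (simp add: finite_nbrs)
qed

lemma finite_set_pmf_walk: "finite (set_pmf (walk n e))"
  by (induction n arbitrary: e) (simp_all add: finite_set_pmf_step)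

lemma pmf_walk_add_ge: "pmf (walk m e) e' * pmf (walk n e') e'' \<le> pmf (walk (m + n) e) e''"
  unfolding chain_at_add by (rule pmf_bind_ge)

lemma pmf_walk_1: "pmf (walk (Suc 0) e) e' = pmf (step e) e'"
proof -
  have "walk 0 = return_pmf" by (rule ext) simp
  then show ?thesis by (simp add: bind_return_pmf')
qed

text \<open>
  Every edge of the lattice lies on two triangles, so one of the two apexes differs from \<open>y\<close>.
\<close>
lemma two_common_nbrs:
  assumes "z \<in> nbrs x"
  shows "\<exists>v. v \<in> nbrs x \<and> z \<in> nbrs v \<and> v \<noteq> y"
proof -
  obtain d where z: "z = x + d" and d: "d \<in> {(1,0), (-1,0), (0,1), (0,-1), (1,-1), (-1,1)}"
    using assms by (auto simp: in_nbrs_iff algebra_simps)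
  \<comment> \<open>The direction \<open>d\<close> turned by 60 degrees to either side.\<close>
  define a where "a = x + (- snd d, fst d + snd d)"
  define b where "b = x + (fst d + snd d, - fst d)"
  have "a \<noteq> b" "a \<in> nbrs x \<and> z \<in> nbrs a" "b \<in> nbrs x \<and> z \<in> nbrs b"
    using d unfolding a_def b_def z in_nbrs_iff
    by (elim insertE emptyE; simp)+
  then show ?thesis by metis
qed

text \<open>
  Walk round a triangle \<open>x, v, z\<close> whose apex \<open>v\<close> is not \<open>y\<close>.  None of the three steps backtracks.
\<close>
lemma triangle_detour:
  assumes "is_edge (y, x)" "z \<in> nbrs x"
  shows "\<delta> ^ 3 \<le> pmf (walk 3 (y, x)) (z, x)"
proof -
  obtain v where v: "v \<in> nbrs x" "z \<in> nbrs v" "v \<noteq> y" using two_common_nbrs[OF assms(2)] by blast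
  have 1: "\<delta> \<le> pmf (step (y, x)) (x, v)" using v by (simp add: pmf_step prob_next_ge)
  have 2: "\<delta> \<le> pmf (step (x, v)) (v, z)"
    using v assms not_in_own_nbrs[of x] by (auto simp: pmf_step intro!: prob_next_ge)
  have 3: "\<delta> \<le> pmf (step (v, z)) (z, x)"
    using v assms not_in_own_nbrs[of x] nbrs_sym[of x z]
    by (auto simp: pmf_step intro!: prob_next_ge)
  have "\<delta> * \<delta> \<le> pmf (walk (Suc 0) (x, v)) (v, z) * pmf (walk (Suc 0) (v, z)) (z, x)"
    unfolding pmf_walk_1 using 2 3 \<delta>_pos by (intro mult_mono) auto
  also have "\<dots> \<le> pmf (walk (Suc (Suc 0)) (x, v)) (z, x)"
    using pmf_walk_add_ge[of "Suc 0" _ _ "Suc 0"] by simp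
  finally have "\<delta> * (\<delta> * \<delta>) \<le> pmf (walk (Suc 0) (y, x)) (x, v) * pmf (walk (Suc (Suc 0)) (x, v)) (z, x)"
    unfolding pmf_walk_1 using 1 \<delta>_pos by (intro mult_mono) auto
  also have "\<dots> \<le> pmf (walk (Suc 0 + Suc (Suc 0)) (y, x)) (z, x)"
    by (rule pmf_walk_add_ge)
  finally show ?thesis by (simp add: power3_eq_cube mult.assoc numeral_3_eq_3)
qed

section \<open>Reversal and the return probability\<close>

definition position :: "nat \<Rightarrow> (int \<times> int) \<times> (int \<times> int) \<Rightarrow> (int \<times> int) pmf" where
  "position n e = map_pmf snd (walk n e)"

text \<open>
  The map \<open>p \<mapsto> w - p\<close> is an automorphism of the lattice.
\<close>
lemma step_point_reflection:
  "step (w - s, w - u) = map_pmf (map_prod ((-) w) ((-) w)) (step (s, u))"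
proof (rule pmf_eqI)
  fix e :: "(int \<times> int) \<times> (int \<times> int)"
  obtain u' v where e: "e = (w - u', w - v)"
    by (metis diff_diff_eq2 add_diff_cancel_left' prod.collapse)
  have edge: "{w - p, w - q} \<in> tri_edges \<longleftrightarrow> {p, q} \<in> tri_edges" for p q
    using tri_edges_iff[of "w - p" "w - q"] tri_edges_iff[of q p]
    by (simp add: insert_commute)
  have "bij_betw ((-) w) tri_vertices tri_vertices"
    by (rule bij_betwI[of _ _ _ "(-) w"]) (auto simp: tri_vertices_def)
  then have p: "prob_next (w - s) (w - u) (w - v) = prob_next s u v"
    using edge by (intro n2v_prob_automorphism) (auto simp: tri_vertices_def)
  have "inj (map_prod ((-) w) ((-) w))" by (auto simp: inj_on_def)
  from pmf_map_inj'[OF this, of "step (s, u)" "(u', v)"]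
  show "pmf (step (w - s, w - u)) e = pmf (map_pmf (map_prod ((-) w) ((-) w)) (step (s, u))) e"
    by (simp add: e pmf_step p)
qed

lemma walk_point_reflection:
  "walk n (map_prod ((-) w) ((-) w) e) = map_pmf (map_prod ((-) w) ((-) w)) (walk n e)"
proof (induction n arbitrary: e)
  case (Suc n)
  have "step (map_prod ((-) w) ((-) w) e) = map_pmf (map_prod ((-) w) ((-) w)) (step e)"
    using step_point_reflection[of w "fst e" "snd e"] by (cases e) simp
  then show ?case by (simp add: bind_map_pmf map_bind_pmf Suc)
qed simp

text \<open>
  The reflection \<open>p \<mapsto> x + v - p\<close> exchanges \<open>x\<close> and \<open>v\<close>, and maps the starting edge \<open>(z, v)\<close> to \<open>(x + v - z, x)\<close>.
\<close>
lemma pmf_position_reflected: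
  "pmf (position n (x + v - z, x)) v = pmf (position n (z, v)) x"
proof -
  have "position n (x + v - z, x) = map_pmf ((-) (x + v)) (position n (z, v))"
    using walk_point_reflection[of n "x + v" "(z, v)"]
    by (simp add: position_def pmf.map_comp comp_def)
  moreover have "inj ((-) (x + v))" by (auto simp: inj_on_def)
  ultimately show ?thesis
    using pmf_map_inj'[of "(-) (x + v)" "position n (z, v)" x] by simp
qed

text \<open>
  Reaching the position \<open>v\<close> by any edge is enough: a triangle detour then produces the wanted edge \<open>(z, v)\<close>.
\<close>
lemma pmf_walk_ge_position:
  assumes "is_edge e" "z \<in> nbrs v"
  shows "\<delta> ^ 3 * pmf (position n e) v \<le> pmf (walk (n + 3) e) (z, v)"
proof -
  have "\<delta> ^ 3 * pmf (position n e) v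
      = measure_pmf.expectation (walk n e) (\<lambda>t. \<delta> ^ 3 * indicator (snd -` {v}) t)"
    by (simp add: position_def pmf_map)
  also have "\<dots> \<le> measure_pmf.expectation (walk n e) (\<lambda>t. pmf (walk 3 t) (z, v))"
  proof (rule integral_mono_AE)
    show "AE t in walk n e. \<delta> ^ 3 * indicator (snd -` {v}) t \<le> pmf (walk 3 t) (z, v)"
      using is_edge_walk[OF assms(1)] triangle_detour[OF _ assms(2)]
      by (auto simp: AE_measure_pmf_iff indicator_def)
  qed (auto intro!: integrable_measure_pmf_finite finite_set_pmf_walk)
  finally show ?thesis by (simp add: chain_at_add pmf_bind)
qed

text \<open>
  Walk \<open>n\<close> steps to some position \<open>x\<close>, make a detour into the reflected edge \<open>(x + v - z, x)\<close>, walk \<open>n\<close> steps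
  to \<open>v\<close>, and make a detour into \<open>(z, v)\<close>.  The two long walks have the same probability, whence the square.
\<close>
lemma return_ge_collision:
  assumes "z \<in> nbrs v"
  shows "\<delta> ^ 6 * measure_pmf.expectation (position n (z, v)) (pmf (position n (z, v)))
    \<le> pmf (walk (2 * n + 6) (z, v)) (z, v)"
proof -
  have e: "is_edge (z, v)" using assms by (simp add: is_edge_def flip: nbrs_sym)
  have half: "\<delta> ^ 6 * pmf (position n (z, v)) (snd t) \<le> pmf (walk (3 + (n + 3)) t) (z, v)"
    if "is_edge t" for t
  proof -
    obtain y x where t: "t = (y, x)" by (cases t)
    have nb: "x + v - z \<in> nbrs x"
      using assms nbrs_sym[of z v] by (auto simp: in_nbrs_iff)
    then have e': "is_edge (x + v - z, x)" by (simp add: is_edge_def flip: nbrs_sym)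
    have "\<delta> ^ 6 * pmf (position n (z, v)) x = \<delta> ^ 3 * (\<delta> ^ 3 * pmf (position n (x + v - z, x)) v)"
      by (simp add: pmf_position_reflected mult.assoc flip: power_add)
    also have "\<dots> \<le> pmf (walk 3 (y, x)) (x + v - z, x) * pmf (walk (n + 3) (x + v - z, x)) (z, v)"
      using \<delta>_pos that nb assms unfolding t
      by (intro mult_mono triangle_detour pmf_walk_ge_position e') auto
    also have "\<dots> \<le> pmf (walk (3 + (n + 3)) (y, x)) (z, v)"
      by (rule pmf_walk_add_ge)
    finally show ?thesis by (simp add: t)
  qed
  have "\<delta> ^ 6 * measure_pmf.expectation (position n (z, v)) (pmf (position n (z, v)))
      = measure_pmf.expectation (walk n (z, v)) (\<lambda>t. \<delta> ^ 6 * pmf (position n (z, v)) (snd t))"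
    by (simp add: position_def)
  also have "\<dots> \<le> measure_pmf.expectation (walk n (z, v)) (\<lambda>t. pmf (walk (3 + (n + 3)) t) (z, v))"
    by (rule integral_mono_AE)
       (use half is_edge_walk[OF e] in \<open>auto simp: AE_measure_pmf_iff
          intro!: integrable_measure_pmf_finite finite_set_pmf_walk\<close>)
  also have "\<dots> = pmf (walk (n + (3 + (n + 3))) (z, v)) (z, v)"
    unfolding chain_at_add[of step n "3 + (n + 3)"] pmf_bind ..
  also have "n + (3 + (n + 3)) = 2 * n + 6" by simp
  finally show ?thesis .
qed

section \<open>Diffusive growth of the second moment\<close>

text \<open>
  In the coordinates used here the squared Euclidean norm on the lattice is \<open>p\<^sub>1\<^sup>2 + p\<^sub>1p\<^sub>2 + p\<^sub>2\<^sup>2\<close>; the polar form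
  below is twice the corresponding inner product, so that
  \<open>sqnorm (p + q) = sqnorm p + polar p q + sqnorm q\<close>.
\<close>
definition sqnorm :: "int \<times> int \<Rightarrow> real" where
  "sqnorm p = real_of_int ((fst p)\<^sup>2 + fst p * snd p + (snd p)\<^sup>2)"

definition polar :: "int \<times> int \<Rightarrow> int \<times> int \<Rightarrow> real" where
  "polar p q = real_of_int (2 * fst p * fst q + fst p * snd q + snd p * fst q + 2 * snd p * snd q)"

text \<open>
  Arriving with direction \<open>(d1, d2)\<close>, the six continuations are that direction turned by \<open>0\<close>, \<open>\<plusminus>60\<close>,
  \<open>\<plusminus>120\<close> and \<open>180\<close> degrees; a turn by 60 degrees maps \<open>(d1, d2)\<close> to \<open>(- d2, d1 + d2)\<close>.
\<close>
lemma sum_weight_by_turn: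
  fixes f :: "int \<times> int \<Rightarrow> real"
  assumes "(d1, d2) \<in> {(1,0), (-1,0), (0,1), (0,-1), (1,-1), (-1,1)}"
  shows "(\<Sum>v\<in>nbrs (a, b). weight (a - d1, b - d2) v * f v) =
    \<gamma> * (f (a + d1, b + d2) + f (a - d2, b + d1 + d2) + f (a + d1 + d2, b - d1))
    + \<beta> * (f (a - d1 - d2, b + d1) + f (a + d2, b - d1 - d2))
    + \<alpha> * f (a - d1, b - d2)"
proof -
  consider "d1 = 1 \<and> d2 = 0" | "d1 = -1 \<and> d2 = 0" | "d1 = 0 \<and> d2 = 1"
    | "d1 = 0 \<and> d2 = -1" | "d1 = 1 \<and> d2 = -1" | "d1 = -1 \<and> d2 = 1"
    using assms by auto
  then show ?thesis
    by cases (simp_all add: nbrs_tri n2v_weight_def tri_edges_iff algebra_simps)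
qed

lemma sqnorm_unit:
  "(w1, w2) \<in> {(1,0), (-1,0), (0,1), (0,-1), (1,-1), (-1,1)} \<Longrightarrow>
    (real_of_int w1)\<^sup>2 + w1 * w2 + (real_of_int w2)\<^sup>2 = 1"
  by auto

text \<open>
  By the symmetry of turns, the expected next direction is \<open>\<lambda>\<close> times the current one, with
  \<open>\<lambda> = (2\<gamma> - \<alpha> - \<beta>) / (\<alpha> + 2\<beta> + 3\<gamma>)\<close>.  Hence \<open>sqnorm x\<close>, whose expected increment involves the inner product of
  position and direction, becomes a function with constant drift once \<open>\<lambda> / (1 - \<lambda>)\<close> times the polar form of
  position and direction is added.  The potential is that function multiplied by \<open>2\<alpha> + 3\<beta> + \<gamma>\<close>, to clear the
  denominator; positions are taken relative to \<open>c\<close>.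
\<close>
definition potential :: "int \<times> int \<Rightarrow> (int \<times> int) \<times> (int \<times> int) \<Rightarrow> real" where
  "potential c e = (2 * \<alpha> + 3 * \<beta> + \<gamma>) * sqnorm (snd e - c)
    + (2 * \<gamma> - \<alpha> - \<beta>) * polar (snd e - c) (snd e - fst e)"

text \<open>
  For a unit vector \<open>w\<close>, \<open>potential c (u, u + w)\<close> is affine in \<open>w\<close>: its linear part is
  \<open>Z = \<alpha> + 2\<beta> + 3\<gamma>\<close> times the polar form of \<open>u - c\<close> and \<open>w\<close>, because \<open>D + k = Z\<close> for the two coefficients
  \<open>D\<close> and \<open>k\<close> of the potential.  The mean of \<open>w\<close> is \<open>k / Z\<close> times the current direction, which
  reproduces the directional term of the potential.
\<close>
lemma expectation_step_potential:
  assumes "is_edge e"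
  shows "measure_pmf.expectation (step e) (potential c) = potential c e + (\<beta> + 5 * \<gamma>)"
proof -
  obtain a b d1 d2 where e: "e = ((a - d1, b - d2), (a, b))"
    by (metis (no_types) diff_diff_eq2 add_diff_cancel_left' prod.collapse)
  have d: "(d1, d2) \<in> {(1,0), (-1,0), (0,1), (0,-1), (1,-1), (-1,1)}"
    using assms unfolding is_edge_def e in_nbrs_iff by simp
  define D k Z where "D = 2 * \<alpha> + 3 * \<beta> + \<gamma>" and "k = 2 * \<gamma> - \<alpha> - \<beta>"
    and "Z = \<alpha> + 2 * \<beta> + 3 * \<gamma>"
  have sumZ: "(\<Sum>v\<in>nbrs (a, b). weight (a - d1, b - d2) v) = Z"
    using sum_weight_by_turn[OF d, of a b "\<lambda>_. 1"] by (simp add: Z_def)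
  have Zpos: "Z > 0" using \<alpha>_nonneg \<beta>_pos \<gamma>_pos by (simp add: Z_def)
  have DkZ: "Z = D + k" and const: "D + 2 * k = \<beta> + 5 * \<gamma>"
    by (simp_all add: D_def k_def Z_def)
  define x y where "x = real_of_int (a - fst c)" and "y = real_of_int (b - snd c)"
  define N where "N = x\<^sup>2 + x * y + y\<^sup>2"
  have pot: "potential c e = D * N + k * ((2 * x + y) * d1 + (x + 2 * y) * d2)"
    unfolding potential_def D_def[symmetric] k_def[symmetric] N_def
    by (simp add: e sqnorm_def polar_def x_def y_def algebra_simps)
  have "potential c ((a, b), v)
      = D * N + (D + 2 * k) + Z * ((2 * x + y) * (fst v - a) + (x + 2 * y) * (snd v - b))"
    if "v \<in> nbrs (a, b)" for v
  proof -
    obtain w1 w2 where v: "v = (a + w1, b + w2)"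
      by (metis add.commute diff_add_cancel prod.collapse)
    define r1 r2 where "r1 = real_of_int w1" and "r2 = real_of_int w2"
    have unit: "r1\<^sup>2 + r1 * r2 + r2\<^sup>2 = 1"
      using that sqnorm_unit[of w1 w2] unfolding v in_nbrs_iff r1_def r2_def by simp
    have "potential c ((a, b), v) = D * ((x + r1)\<^sup>2 + (x + r1) * (y + r2) + (y + r2)\<^sup>2)
        + k * (2 * (x + r1) * r1 + (x + r1) * r2 + (y + r2) * r1 + 2 * (y + r2) * r2)"
      unfolding potential_def v D_def[symmetric] k_def[symmetric]
      by (simp add: sqnorm_def polar_def x_def y_def r1_def r2_def diff_add_eq)
    also have "\<dots> = D * N + (D + 2 * k) * (r1\<^sup>2 + r1 * r2 + r2\<^sup>2)
        + Z * ((2 * x + y) * r1 + (x + 2 * y) * r2)"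
      unfolding DkZ N_def by algebra
    finally show ?thesis unfolding unit by (simp add: v r1_def r2_def)
  qed
  then have "(\<Sum>v\<in>nbrs (a, b). weight (a - d1, b - d2) v * potential c ((a, b), v))
      = (\<Sum>v\<in>nbrs (a, b). weight (a - d1, b - d2) v *
          (D * N + (D + 2 * k) + Z * ((2 * x + y) * (fst v - a) + (x + 2 * y) * (snd v - b))))"
    by (intro sum.cong) auto
  also have "\<dots> = Z * (D * N + (D + 2 * k) + k * ((2 * x + y) * d1 + (x + 2 * y) * d2))"
    unfolding sum_weight_by_turn[OF d] by (simp add: Z_def k_def) algebra
  also have "\<dots> = Z * (potential c e + (\<beta> + 5 * \<gamma>))"
    unfolding pot const by simp
  finally have "(\<Sum>v\<in>nbrs (a, b). weight (a - d1, b - d2) v * potential c ((a, b), v))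
      = Z * (potential c e + (\<beta> + 5 * \<gamma>))" .
  moreover have "measure_pmf.expectation (step e) (potential c)
      = (\<Sum>v\<in>nbrs (a, b). weight (a - d1, b - d2) v * potential c ((a, b), v)) / Z"
    unfolding e expectation_step sum_divide_distrib
    by (intro sum.cong) (auto simp: n2v_prob_def sumZ)
  ultimately show ?thesis using Zpos by simp
qed

lemma expectation_walk_potential:
  assumes "is_edge e"
  shows "measure_pmf.expectation (walk n e) (potential c) = potential c e + n * (\<beta> + 5 * \<gamma>)"
proof (induction n)
  case (Suc n)
  have w1: "walk (Suc 0) = step" by (rule ext, rule pmf_eqI, rule pmf_walk_1)
  have "measure_pmf.expectation (walk (n + Suc 0) e) (potential c)
      = (\<Sum>t\<in>set_pmf (walk n e). pmf (walk n e) t * measure_pmf.expectation (step t) (potential c))"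
    unfolding chain_at_add w1
    by (subst pmf_expectation_bind[OF finite_set_pmf_walk[of n e]])
       (auto intro: finite_set_pmf_step)
  also have "\<dots> = (\<Sum>t\<in>set_pmf (walk n e). pmf (walk n e) t * (potential c t + (\<beta> + 5 * \<gamma>)))"
    using is_edge_walk[OF assms] by (intro sum.cong refl arg_cong2[where f = "(*)"] expectation_step_potential)
  also have "\<dots> = measure_pmf.expectation (walk n e) (\<lambda>t. potential c t + (\<beta> + 5 * \<gamma>))"
    by (subst integral_measure_pmf_real[OF finite_set_pmf_walk[of n e]]) (auto simp: mult.commute)
  also have "\<dots> = potential c e + Suc n * (\<beta> + 5 * \<gamma>)"
    by (subst Bochner_Integration.integral_add)
       (auto simp: Suc algebra_simps intro!: integrable_measure_pmf_finite finite_set_pmf_walk)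
  finally show ?case by simp
qed simp

text \<open>
  Complete the square: with \<open>D = 2\<alpha> + 3\<beta> + \<gamma>\<close> and \<open>k = 2\<gamma> - \<alpha> - \<beta>\<close>, the vector \<open>D x + 2k d\<close> has nonnegative square
  norm, where \<open>x\<close> is the relative position and the direction \<open>d\<close> is a unit vector.
\<close>
lemma sqnorm_le_potential:
  assumes "is_edge e"
  shows "(2 * \<alpha> + 3 * \<beta> + \<gamma>) * sqnorm (snd e - c) \<le> 2 * potential c e + 16 * (2 * \<alpha> + 3 * \<beta> + \<gamma>)"
proof -
  define x y d1 d2 where "x = real_of_int (fst (snd e - c))" and "y = real_of_int (snd (snd e - c))"
    and "d1 = real_of_int (fst (snd e - fst e))" and "d2 = real_of_int (snd (snd e - fst e))"
  note defs = this
  define D where "D = 2 * \<alpha> + 3 * \<beta> + \<gamma>"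
  define k where "k = 2 * \<gamma> - \<alpha> - \<beta>"
  have D: "D > 0" and k: "\<bar>k\<bar> \<le> 2 * D"
    using \<alpha>_nonneg \<beta>_pos \<gamma>_pos unfolding D_def k_def by auto
  have unit: "d1\<^sup>2 + d1 * d2 + d2\<^sup>2 = 1"
    using assms unfolding is_edge_def in_nbrs_iff defs by (auto simp del: of_int_diff fst_diff snd_diff)
  have sq: "sqnorm (snd e - c) = x\<^sup>2 + x * y + y\<^sup>2"
    by (simp add: sqnorm_def defs)
  have pot: "potential c e = D * (x\<^sup>2 + x * y + y\<^sup>2) + k * (2 * x * d1 + x * d2 + y * d1 + 2 * y * d2)"
    unfolding potential_def sq D_def[symmetric] k_def[symmetric] by (simp add: polar_def defs)
  define p q where "p = D * x + 2 * k * d1" and "q = D * y + 2 * k * d2"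
  have "0 \<le> (p + q / 2)\<^sup>2 + 3 / 4 * q\<^sup>2" by simp
  also have "\<dots> = p\<^sup>2 + p * q + q\<^sup>2" by (simp add: power2_eq_square field_simps)
  also have "\<dots> = D * (2 * potential c e - D * sqnorm (snd e - c)) + 4 * k\<^sup>2 * (d1\<^sup>2 + d1 * d2 + d2\<^sup>2)"
    unfolding pot sq p_def q_def by algebra
  also have "\<dots> = D * (2 * potential c e - D * sqnorm (snd e - c)) + 4 * k\<^sup>2" by (simp add: unit)
  also have "4 * k\<^sup>2 \<le> D * (16 * D)"
    using power_mono[OF k, of 2] by (simp add: power2_eq_square)
  finally have "0 \<le> D * (2 * potential c e - D * sqnorm (snd e - c) + 16 * D)"
    by (simp add: algebra_simps)
  then show ?thesis using D by (simp add: zero_le_mult_iff D_def)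
qed

lemma expectation_sqnorm_le:
  assumes "is_edge (z, v)"
  shows "measure_pmf.expectation (position n (z, v)) (\<lambda>x. sqnorm (x - v)) \<le> 16 * (n + 1)"
proof -
  let ?D = "2 * \<alpha> + 3 * \<beta> + \<gamma>"
  have int: "integrable (walk n (z, v)) f" for f :: "_ \<Rightarrow> real"
    by (intro integrable_measure_pmf_finite finite_set_pmf_walk)
  have "?D * measure_pmf.expectation (position n (z, v)) (\<lambda>x. sqnorm (x - v))
      = measure_pmf.expectation (walk n (z, v)) (\<lambda>e. ?D * sqnorm (snd e - v))"
    by (simp add: position_def)
  also have "\<dots> \<le> measure_pmf.expectation (walk n (z, v)) (\<lambda>e. 2 * potential v e + 16 * ?D)"
    using sqnorm_le_potential is_edge_walk[OF assms]
    by (intro integral_mono_AE int) (auto simp: AE_measure_pmf_iff)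
  also have "\<dots> = 2 * measure_pmf.expectation (walk n (z, v)) (potential v) + 16 * ?D"
    by (subst Bochner_Integration.integral_add) (auto intro: int)
  also have "\<dots> = 2 * (n * (\<beta> + 5 * \<gamma>)) + 16 * ?D"
    by (subst expectation_walk_potential[OF assms]) (simp add: potential_def sqnorm_def polar_def)
  also have "\<dots> \<le> ?D * (16 * (n + 1))"
  proof -
    have "real n * (\<beta> + 5 * \<gamma>) \<le> real n * (8 * ?D)"
      using \<alpha>_nonneg \<beta>_pos \<gamma>_pos by (intro mult_left_mono) auto
    then show ?thesis by (simp add: algebra_simps)
  qed
  finally show ?thesis
    using \<alpha>_nonneg \<beta>_pos \<gamma>_pos by (subst (asm) mult_le_cancel_left_pos) auto
qed

text \<open>
  By Markov's inequality at least half of the mass lies in a box of side of order \<open>\<surd>n\<close> about \<open>v\<close>, which has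
  \<open>O(n)\<close> points.
\<close>
lemma collision_ge:
  assumes "is_edge (z, v)"
  shows "1 / (900 * (real n + 1))
    \<le> measure_pmf.expectation (position n (z, v)) (pmf (position n (z, v)))"
proof -
  let ?p = "position n (z, v)"
  \<comment> \<open>Outside the box of radius \<open>r\<close>, \<open>sqnorm\<close> is at least \<open>3/4 * 49 * (n + 1)\<close>, more than twice the
    bound for its mean.\<close>
  define r where "r = nat \<lfloor>7 * sqrt (real n + 1)\<rfloor>"
  have r_le: "real r \<le> 7 * sqrt (real n + 1)" and r_gt: "7 * sqrt (real n + 1) < real r + 1"
    unfolding r_def by (auto simp: of_nat_nat)
  define B where "B = {fst v - int r..fst v + int r} \<times> {snd v - int r..snd v + int r}"
  have B: "finite B" "B \<noteq> {}" "real (card B) = (2 * real r + 1)\<^sup>2"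
    by (auto simp: B_def card_cartesian_product power2_eq_square)
  have far: "32 * (real n + 1) \<le> sqnorm (x - v)" if "x \<notin> B" for x
  proof -
    define a b where "a = fst x - fst v" and "b = snd x - snd v"
    have "int r + 1 \<le> \<bar>a\<bar> \<or> int r + 1 \<le> \<bar>b\<bar>"
      using that by (cases x) (auto simp: B_def a_def b_def)
    then have "real r + 1 \<le> \<bar>real_of_int a\<bar> \<or> real r + 1 \<le> \<bar>real_of_int b\<bar>"
      by linarith
    then have far_coordinate: "(real r + 1)\<^sup>2 \<le> (real_of_int a)\<^sup>2 \<or> (real r + 1)\<^sup>2 \<le> (real_of_int b)\<^sup>2"
      using power_mono[of "real r + 1" "\<bar>real_of_int a\<bar>" 2]
        power_mono[of "real r + 1" "\<bar>real_of_int b\<bar>" 2] by auto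
    have r2: "49 * (real n + 1) \<le> (real r + 1)\<^sup>2"
      using power_mono[OF less_imp_le[OF r_gt], of 2] by (simp add: power_mult_distrib)
    have "sqnorm (x - v) = 3 / 4 * (real_of_int a)\<^sup>2 + (a / 2 + b)\<^sup>2"
      and "sqnorm (x - v) = 3 / 4 * (real_of_int b)\<^sup>2 + (b / 2 + a)\<^sup>2"
      by (simp_all add: sqnorm_def a_def b_def power2_eq_square field_simps)
    then have sq: "3 / 4 * (real_of_int a)\<^sup>2 \<le> sqnorm (x - v)"
      "3 / 4 * (real_of_int b)\<^sup>2 \<le> sqnorm (x - v)"
      by (metis le_add_same_cancel1 zero_le_power2)+
    from far_coordinate show ?thesis
    proof
      assume "(real r + 1)\<^sup>2 \<le> (real_of_int a)\<^sup>2"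
      with r2 sq(1) show ?thesis by simp
    next
      assume "(real r + 1)\<^sup>2 \<le> (real_of_int b)\<^sup>2"
      with r2 sq(2) show ?thesis by simp
    qed
  qed
  have fin: "finite (set_pmf ?p)" by (simp add: position_def finite_set_pmf_walk)
  have nonneg: "0 \<le> sqnorm x" for x
  proof -
    have "sqnorm x = 3 / 4 * (real_of_int (fst x))\<^sup>2 + (fst x / 2 + snd x)\<^sup>2"
      by (simp add: sqnorm_def power2_eq_square field_simps)
    then show ?thesis by simp
  qed
  have "32 * (real n + 1) * measure_pmf.prob ?p (- B)
      = measure_pmf.expectation ?p (\<lambda>x. 32 * (real n + 1) * indicator (- B) x)"
    by simp
  also have "\<dots> \<le> measure_pmf.expectation ?p (\<lambda>x. sqnorm (x - v))"
    using far nonneg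
    by (intro integral_mono integrable_measure_pmf_finite fin) (auto simp: indicator_def)
  also have "\<dots> \<le> 32 * (real n + 1) * (1 / 2)" using expectation_sqnorm_le[OF assms, of n] by simp
  finally have "measure_pmf.prob ?p (- B) \<le> 1 / 2" by (subst (asm) mult_le_cancel_left_pos) auto
  moreover have "measure_pmf.prob ?p (- B) = 1 - measure_pmf.prob ?p B"
    using measure_pmf.prob_compl[of B ?p] by (simp add: Compl_eq_Diff_UNIV)
  ultimately have "(1 / 2)\<^sup>2 \<le> (measure_pmf.prob ?p B)\<^sup>2" by (intro power_mono) auto
  then have half: "1 / 4 \<le> (measure_pmf.prob ?p B)\<^sup>2" by (simp add: power2_eq_square)
  have "1 \<le> sqrt (real n + 1)" by simp
  then have "2 * real r + 1 \<le> 15 * sqrt (real n + 1)" using r_le by linarith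
  then have "(2 * real r + 1)\<^sup>2 \<le> (15 * sqrt (real n + 1))\<^sup>2" by (intro power_mono) auto
  then have card: "real (card B) \<le> 225 * (real n + 1)" by (simp add: B power_mult_distrib)
  have "1 / (900 * (real n + 1)) = (1 / 4) / (225 * (real n + 1))" by simp
  also have "\<dots> \<le> (measure_pmf.prob ?p B)\<^sup>2 / real (card B)"
    using half card B by (intro frac_le) (auto simp: card_gt_0_iff)
  also have "\<dots> \<le> measure_pmf.expectation ?p (pmf ?p)"
    by (rule collision_probability_ge[OF B(1,2)])
  finally show ?thesis .
qed

lemma not_summable_return:
  assumes "z \<in> nbrs v"
  shows "\<not> summable (\<lambda>n. pmf (walk n (z, v)) (z, v))"
proof
  let ?f = "\<lambda>n. pmf (walk n (z, v)) (z, v)"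
  have e: "is_edge (z, v)" using assms by (simp add: is_edge_def flip: nbrs_sym)
  assume "summable ?f"
  then have "summable (?f \<circ> (\<lambda>n. 2 * n + 6))"
    by (rule summable_reindex) (auto simp: inj_on_def)
  moreover have "\<delta> ^ 6 / 900 * (1 / (real n + 1)) \<le> (?f \<circ> (\<lambda>n. 2 * n + 6)) n" for n
  proof -
    have "\<delta> ^ 6 / 900 * (1 / (real n + 1)) = \<delta> ^ 6 * (1 / (900 * (real n + 1)))" by simp
    also have "\<dots> \<le> \<delta> ^ 6 * measure_pmf.expectation (position n (z, v)) (pmf (position n (z, v)))"
      using \<delta>_pos by (intro mult_left_mono collision_ge e) auto
    also have "\<dots> \<le> (?f \<circ> (\<lambda>n. 2 * n + 6)) n"
      using return_ge_collision[OF assms] by (simp del: chain_at.simps)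
    finally show ?thesis .
  qed
  ultimately have "summable (\<lambda>n. \<delta> ^ 6 / 900 * (1 / (real n + 1)))"
    using \<delta>_pos by - (rule summable_comparison_test'[where N = 0], auto)
  then have "summable (\<lambda>n. 1 / (real n + 1))"
    using \<delta>_pos by (subst (asm) summable_cmult_iff) auto
  then have "summable (\<lambda>n. inverse (real (Suc n)))"
    by (simp add: inverse_eq_divide add.commute)
  then show False
    using not_summable_harmonic[where 'a = real] by (subst (asm) summable_Suc_iff) simp
qed

section \<open>Irreducibility on directed edges\<close>

abbreviation "reachable \<equiv> {(e, e'). e' \<in> set_pmf (step e)}\<^sup>*"

lemma lattice_induct:
  fixes x v :: "int \<times> int"
  assumes base: "Q v" and nbr: "\<And>x y. Q x \<Longrightarrow> y \<in> nbrs x \<Longrightarrow> Q y"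
  shows "Q x"
proof -
  have row: "Q (a, snd v)" for a
  proof (induction a rule: int_induct[of _ "fst v"])
    case base
    then show ?case using assms(1) by simp
  next
    case (step1 i)
    then show ?case by (auto intro: nbr[of "(i, snd v)"] simp: nbrs_tri)
  next
    case (step2 i)
    then show ?case by (auto intro: nbr[of "(i, snd v)"] simp: nbrs_tri)
  qed
  have "Q (fst x, b)" for b
  proof (induction b rule: int_induct[of _ "snd v"])
    case base
    then show ?case by (rule row)
  next
    case (step1 i)
    then show ?case by (auto intro: nbr[of "(fst x, i)"] simp: nbrs_tri)
  next
    case (step2 i)
    then show ?case by (auto intro: nbr[of "(fst x, i)"] simp: nbrs_tri)
  qed
  from this[of "snd x"] show ?thesis by simp
qed

text \<open>
  Triangle detours change the incoming edge at a fixed vertex at will, so backtracking is never needed to move on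
  to a prescribed neighbour.
\<close>
lemma reachable_edges:
  assumes "z \<in> nbrs v" "is_edge e"
  shows "((z, v), e) \<in> reachable"
proof -
  have turn: "((y, x), (y', x)) \<in> reachable" if "y \<in> nbrs x" "y' \<in> nbrs x" for x y y'
  proof -
    have "\<delta> ^ 3 \<le> pmf (walk 3 (y, x)) (y', x)"
      using that nbrs_sym by (intro triangle_detour) (auto simp: is_edge_def)
    then have "(y', x) \<in> set_pmf (walk 3 (y, x))"
      using zero_less_power[OF \<delta>_pos, of 3] by (auto simp: set_pmf_iff simp del: zero_less_power)
    then show ?thesis by (rule reachable_of_chain_at)
  qed
  have "\<forall>y\<in>nbrs x. ((z, v), (y, x)) \<in> reachable" for x
  proof (induction x rule: lattice_induct[of _ v])
    case 1
    then show ?case using turn assms(1) by blast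
  next
    case (2 x x')
    have "\<not> nbrs x \<subseteq> {x'}"
      using card_mono[of "{x'}" "nbrs x"] by (auto simp: card_nbrs)
    then obtain y where y: "y \<in> nbrs x" "y \<noteq> x'" by blast
    have "\<delta> \<le> pmf (step (y, x)) (x, x')"
      using 2 y by (simp add: pmf_step prob_next_ge)
    then have "((y, x), (x, x')) \<in> reachable"
      using \<delta>_pos by (auto simp: set_pmf_iff)
    moreover have "((z, v), (y, x)) \<in> reachable" using 2 y by blast
    ultimately have "((z, v), (x, x')) \<in> reachable" by (rule rtrancl_trans[rotated])
    then show ?case using turn[of x x'] 2 nbrs_sym[of x x'] by (blast intro: rtrancl_trans)
  qed
  then show ?thesis using assms(2) nbrs_sym unfolding is_edge_def by (metis prod.collapse)
qed

end

section \<open>From the chain to the process\<close>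

text \<open>
  The transition law conditions on whole histories, so the process is compared with the chain history by history.
\<close>
locale tri_walk = tri_node2vec \<alpha> \<beta> \<gamma> + node2vec_walk M tri_vertices tri_edges \<alpha> \<beta> \<gamma> X
  for M :: "'w measure" and \<alpha> \<beta> \<gamma> :: real and X :: "nat \<Rightarrow> 'w \<Rightarrow> int \<times> int"
begin

lemma measurable_X [measurable]: "X n \<in> measurable M (count_space UNIV)"
  using random_variable_X[of n] by (simp add: tri_vertices_def)

definition follows :: "(nat \<Rightarrow> int \<times> int) \<Rightarrow> nat \<Rightarrow> 'w set" where
  "follows x n = {\<omega> \<in> space M. \<forall>i\<le>n. X i \<omega> = x i}"

lemma follows_event [measurable]: "follows x n \<in> events"
  unfolding follows_def by measurable

lemma prob_follows_Suc:
  assumes "n \<ge> 1"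
  shows "prob (follows x (Suc n)) = prob (follows x n) * prob_next (x (n - 1)) (x n) (x (Suc n))"
proof (cases "prob (follows x n) = 0")
  case True
  have "prob (follows x (Suc n)) \<le> prob (follows x n)"
    by (rule finite_measure_mono) (auto simp: follows_def)
  then show ?thesis using True by (simp add: measure_le_0_iff)
next
  case False
  then have pos: "prob (follows x n) > 0" by (simp add: zero_less_measure_iff)
  have "follows x (Suc n) = {\<omega> \<in> space M. X (n + 1) \<omega> = x (Suc n) \<and> (\<forall>i\<le>n. X i \<omega> = x i)}"
    by (auto simp: follows_def le_Suc_eq)
  then have "prob (follows x (Suc n)) / prob (follows x n) = prob_next (x (n - 1)) (x n) (x (Suc n))"
    using transition[OF assms pos[unfolded follows_def], of "x (Suc n)"]
    by (simp add: cond_prob_def follows_def tri_vertices_def)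
  then show ?thesis using pos by (simp add: field_simps)
qed

lemma is_edge_of_follows:
  assumes "n \<ge> 1" "prob (follows x n) > 0"
  shows "is_edge (x (n - 1), x n)"
proof (cases "n = 1")
  case True
  have "{x 0, x 1} \<in> tri_edges"
  proof (rule ccontr)
    assume no_edge: "{x 0, x 1} \<notin> tri_edges"
    have start: "X 0 \<omega> = x 0 \<and> X 1 \<omega> = x 1" if "\<omega> \<in> follows x n" for \<omega>
      using that by (simp add: follows_def True)
    have "AE \<omega> in M. \<omega> \<notin> follows x n"
      using initial_edge by eventually_elim (use start no_edge in metis)
    then have "prob (follows x n) = 0" by (simp add: prob_eq_0)
    then show False using assms(2) by simp
  qed
  then have "x 1 \<in> nbrs (x 0)" unfolding nbrs_def by (simp add: tri_vertices_def)
  then show ?thesis using True by (simp add: is_edge_def)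
next
  case False
  then obtain m where m: "n = Suc m" "m \<ge> 1" using assms(1) by (cases n) auto
  have "prob_next (x (m - 1)) (x m) (x (Suc m)) \<noteq> 0"
    using assms(2) prob_follows_Suc[OF m(2), of x] by (auto simp: m)
  then have "x (Suc m) \<in> nbrs (x m)" using prob_next_eq_0 by blast
  then show ?thesis by (simp add: m is_edge_def)
qed

text \<open>
  Steps are dated by their time of arrival: the first one that counts leaves at time \<open>m\<close>, and belongs partly to
  the history up to time \<open>m\<close>.
\<close>
definition misses :: "int \<times> int \<Rightarrow> int \<times> int \<Rightarrow> nat \<Rightarrow> nat \<Rightarrow> 'w set" where
  "misses z v m n = {\<omega> \<in> space M. \<forall>j\<in>{m<..n}. \<not> (X (j - 1) \<omega> = z \<and> X j \<omega> = v)}"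

lemma misses_event [measurable]: "misses z v m n \<in> events"
  unfolding misses_def by measurable

text \<open>
  Split according to the position \<open>y\<close> at time \<open>n + 1\<close>.  Each piece is governed by the history extended
  by \<open>y\<close>, and the pieces recombine to the recursion that defines \<open>avoid\<close>.
\<close>
lemma prob_follows_misses_le:
  assumes "n \<ge> 1"
  shows "prob (follows x n \<inter> misses z v n (n + N))
    \<le> prob (follows x n) * avoid step (z, v) N (x (n - 1), x n)"
  using assms
proof (induction N arbitrary: n x)
  case 0
  show ?case by (auto intro: finite_measure_mono)
next
  case (Suc N)
  let ?L = "follows x n \<inter> misses z v n (n + Suc N)"
  let ?x = "\<lambda>y. x(Suc n := y)"
  let ?T = "nbrs (x n)"
  \<comment> \<open>On this history, the next position is not a neighbour of \<open>x n\<close>.  This is a null event because the transition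
    probabilities to the neighbours already sum to one.\<close>
  define bad where "bad = follows x n - (\<Union>y\<in>?T. follows (?x y) (Suc n))"
  have follows_upd: "prob (follows (?x y) (Suc n)) = prob (follows x n) * prob_next (x (n - 1)) (x n) y" for y
  proof -
    have "follows (?x y) n = follows x n" by (simp add: follows_def)
    moreover have "n - 1 \<noteq> Suc n" by simp
    ultimately show ?thesis using prob_follows_Suc[OF Suc.prems, of "?x y"] by simp
  qed
  have disj: "disjoint_family_on (\<lambda>y. follows (?x y) (Suc n)) ?T"
    by (auto simp: disjoint_family_on_def follows_def)
  have "prob (\<Union>y\<in>?T. follows (?x y) (Suc n)) = (\<Sum>y\<in>?T. prob (follows (?x y) (Suc n)))"
    by (rule finite_measure_finite_Union[OF finite_nbrs _ disj]) auto
  also have "\<dots> = prob (follows x n)"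
    by (simp add: follows_upd sum_prob_next flip: sum_distrib_left)
  finally have "prob bad = 0"
    unfolding bad_def by (subst finite_measure_Diff) (auto simp: follows_def le_Suc_eq)
  have piece: "prob (?L \<inter> follows (?x y) (Suc n)) \<le>
      prob (follows x n) * prob_next (x (n - 1)) (x n) y *
        (if (x n, y) = (z, v) then 0 else avoid step (z, v) N (x n, y))" for y
  proof (cases "(x n, y) = (z, v)")
    case True
    then have "?L \<inter> follows (?x y) (Suc n) = {}"
      by (force simp: misses_def follows_def)
    then show ?thesis using True by simp
  next
    case False
    have "prob (?L \<inter> follows (?x y) (Suc n))
        \<le> prob (follows (?x y) (Suc n) \<inter> misses z v (Suc n) (Suc n + N))"
      by (rule finite_measure_mono) (auto simp: misses_def)
    also have "\<dots> \<le> prob (follows (?x y) (Suc n)) * avoid step (z, v) N (x n, y)"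
      using Suc.IH[of "Suc n" "?x y"] by (simp add: fun_upd_def)
    finally show ?thesis unfolding follows_upd if_not_P[OF False] .
  qed
  have "prob ?L \<le> prob (bad \<union> (\<Union>y\<in>?T. ?L \<inter> follows (?x y) (Suc n)))"
    using finite_nbrs by (intro finite_measure_mono) (auto simp: bad_def)
  also have "\<dots> \<le> prob bad + prob (\<Union>y\<in>?T. ?L \<inter> follows (?x y) (Suc n))"
    using finite_nbrs by (intro measure_Un_le) (auto simp: bad_def)
  also have "\<dots> \<le> (\<Sum>y\<in>?T. prob (?L \<inter> follows (?x y) (Suc n)))"
    unfolding \<open>prob bad = 0\<close> add_0 by (rule measure_UNION_le[OF finite_nbrs]) auto
  also have "\<dots> \<le> (\<Sum>y\<in>?T. prob (follows x n) * prob_next (x (n - 1)) (x n) y *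
        (if (x n, y) = (z, v) then 0 else avoid step (z, v) N (x n, y)))"
    by (intro sum_mono piece)
  also have "\<dots> = prob (follows x n) * avoid step (z, v) (Suc N) (x (n - 1), x n)"
    by (simp add: expectation_step sum_distrib_left mult.assoc)
  finally show ?case .
qed

text \<open>
  Given a history up to time \<open>n\<close>, the probability of never traversing the edge again is bounded by avoidance
  probabilities of the chain, which tend to zero.  The histories, coded as lists, are countable in number.
\<close>
lemma traverses_edge_again:
  assumes "z \<in> nbrs v" "n \<ge> 1"
  shows "AE \<omega> in M. \<exists>j>n. X (j - 1) \<omega> = z \<and> X j \<omega> = v"
proof -
  let ?never = "\<Inter>N. misses z v n (n + N)"
  have null: "AE \<omega> in M. \<omega> \<notin> follows x n \<inter> ?never" for x
  proof -
    have "prob (follows x n \<inter> ?never) = 0"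
    proof (cases "prob (follows x n) = 0")
      case True
      have "prob (follows x n \<inter> ?never) \<le> prob (follows x n)"
        by (rule finite_measure_mono) auto
      then show ?thesis using True by (simp add: measure_le_0_iff)
    next
      case False
      then have edge: "is_edge (x (n - 1), x n)"
        using assms(2) by (intro is_edge_of_follows) (auto simp: zero_less_measure_iff)
      let ?a = "\<lambda>N. avoid step (z, v) N (x (n - 1), x n)"
      have "?a \<longlonglongrightarrow> 0"
        by (rule avoid_tendsto_0_of_reachable[OF avoid_self_tendsto_0 reachable_edges])
           (use assms(1) edge not_summable_return in auto)
      then have lim: "(\<lambda>N. prob (follows x n) * ?a N) \<longlonglongrightarrow> 0"
        by (rule tendsto_mult_right_zero)
      have "prob (follows x n \<inter> ?never) \<le> prob (follows x n) * ?a N" for N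
      proof -
        have "prob (follows x n \<inter> ?never) \<le> prob (follows x n \<inter> misses z v n (n + N))"
          by (rule finite_measure_mono) auto
        also have "\<dots> \<le> prob (follows x n) * ?a N"
          by (rule prob_follows_misses_le[OF assms(2)])
        finally show ?thesis .
      qed
      then have "prob (follows x n \<inter> ?never) \<le> 0"
        by (intro LIMSEQ_le_const[OF lim]) auto
      then show ?thesis by (simp add: measure_le_0_iff)
    qed
    then show ?thesis by (subst (asm) prob_eq_0) auto
  qed
  have "AE \<omega> in M. \<forall>l :: (int \<times> int) list. \<omega> \<notin> follows ((!) l) n \<inter> ?never"
    unfolding AE_all_countable using null by blast
  with AE_space show ?thesis
  proof eventually_elim
    case (elim \<omega>)
    have "\<omega> \<in> follows ((!) (map (\<lambda>i. X i \<omega>) [0..<Suc n])) n"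
      using elim(1) by (auto simp: follows_def simp del: upt_Suc)
    then obtain N where "\<omega> \<notin> misses z v n (n + N)" using elim(2) by blast
    then show ?case using elim(1) by (auto simp: misses_def)
  qed
qed

lemma recurrent_walk: "recurrent M tri_vertices X"
  unfolding recurrent_def
proof
  fix v :: "int \<times> int"
  obtain z where z: "z \<in> nbrs v"
    using card_nbrs[of v] by (metis card.empty equals0I zero_neq_numeral)
  have "AE \<omega> in M. \<exists>j>n. X j \<omega> = v" for n
  proof -
    have "AE \<omega> in M. \<exists>j>Suc n. X (j - 1) \<omega> = z \<and> X j \<omega> = v"
      using z by (rule traverses_edge_again) simp
    then show ?thesis by eventually_elim (metis Suc_lessD)
  qed
  then show "AE \<omega> in M. \<exists>\<^sub>\<infinity>n. X n \<omega> = v"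
    unfolding INFM_nat by (simp add: AE_all_countable)
qed

end

theorem corollary3p11:
  fixes M :: "'w measure" and X :: "nat \<Rightarrow> 'w \<Rightarrow> int \<times> int" and \<alpha> \<beta> \<gamma> :: real
  assumes "\<alpha> \<ge> 0" and "\<beta> > 0" and "\<gamma> > 0"
    and "node2vec_walk M tri_vertices tri_edges \<alpha> \<beta> \<gamma> X"
  shows "recurrent M tri_vertices X"
proof -
  interpret node2vec_walk M tri_vertices tri_edges \<alpha> \<beta> \<gamma> X by (rule assms(4))
  interpret tri_walk M \<alpha> \<beta> \<gamma> X by unfold_locales (use assms(1-3) in auto)
  show ?thesis by (rule recurrent_walk)
qed

end
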